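(* Let $m \geqslant 2$ and $n_1,n_2 \geqslant 1$ be integers such that $q_1 = 1+mn_1$ and $q_2 = 1+mn_2$ are prime powers, and let $\alpha_1$ and $\alpha_2$ be primitive elements of $\operatorname{GF}(q_1)$ and $\operatorname{GF}(q_2)$, respectively. Then $\Gamma_m(\alpha_1,\alpha_2)$ is a Neumaier graph if and only if $q_1n_1 \equiv q_2n_2 \pmod 2$ and \[ \mathcal X^{(m)}_{0,0,0}(\alpha_1,\alpha_2) = q_1+n_1 n_2-2n_1-n_2. \] Furthermore, in that case $\Gamma_m(\alpha_1,\alpha_2)$ has parameters $\left (q_1 q_2, (q_1-1)(n_2+1), q_1-2+(n_1-1)n_2; n_1, q_1\right )$, and the number of common neighbours of any pair of distinct nonadjacent vertices belongs to the set \[ \{n_1(n_2+1)\} \cup \bigcup_{i=1}^{m-1} \left\{ 2n_1+ \mathcal X^{(m)}_{0,0,i}(\alpha_1,\alpha_2)\right\}. \]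
   Context: For a prime power $q \equiv 1 \pmod m$ and a primitive element $\alpha$ of $\operatorname{GF}(q)$, the cyclotomic number of order $m$ is, for $a,b\in\mathbb Z$, $c_m(\alpha;a,b) = |\{\alpha^k+1 : k \equiv a \pmod m\} \cap \{\alpha^k : k \equiv b \pmod m\}|$ (so it depends only on $a,b$ modulo $m$). Define $\mathcal X^{(m)}_{i,j,k}(\alpha_1,\alpha_2) = \sum_{a=0}^{m-1}\sum_{b=0}^{m-1} c_m(\alpha_1;a,b)\,c_m(\alpha_2;a+i-j,b+i-k)$. Let $\mathsf C_1(\alpha_1) = \{(\alpha_1^k,0): 0\le k\le q_1-2\}$ and, for $i\in\{0,\dots,m-1\}$, $\mathsf D_i(\alpha_1,\alpha_2) = \{(\alpha_1^{i_1},\alpha_2^{i_2}) : i_1-i_2 \equiv i \pmod m\}$, subsets of the additive group $\operatorname{GF}(q_1)\times\operatorname{GF}(q_2)$. The Cayley digraph $\operatorname{Cay}(G,S)$ of an abelian group $G$ has vertex set $G$ and arcs $(g,s+g)$ for $g\in G$, $s \in S$. Define $\Gamma_m(\alpha_1,\alpha_2) = \operatorname{Cay}(\operatorname{GF}(q_1)\times\operatorname{GF}(q_2), \mathsf C_1(\alpha_1)\cup \mathsf D_0(\alpha_1,\alpha_2))$. A graph is $(v,k,\lambda)$-edge-regular if it has $v$ vertices, is $k$-regular, and each edge lies in exactly $\lambda$ triangles. A clique $C$ is $e$-regular ($e>0$) if every vertex outside $C$ is adjacent to exactly $e$ vertices of $C$. A Neumaier graph is a non-complete (undirected, simple) edge-regular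 graph with a regular clique; it has parameters $(v,k,\lambda;e,s)$ if it is $(v,k,\lambda)$-edge-regular and has an $e$-regular clique of order $s$. *)

theory Defs
  imports
    "Graph_Theory.Kuratowski"
    "HOL-Number_Theory.Number_Theory"
    "HOL-Computational_Algebra.Primes"
    "HOL-Library.Cardinality"
    "HOL-Library.Product_Plus"
begin

text \<open>
  GF(q) is a type of class \<^class>\<open>finite_field\<close> whose universe has q elements.
  A primitive element generates the multiplicative group, i.e. its integer powers are exactly
  the nonzero elements (\<open>\<alpha> = 0\<close> is excluded, as 0 would be among its powers).
\<close>
definition primitive_element :: "'a::finite_field \<Rightarrow> bool" where
  "primitive_element \<alpha> \<longleftrightarrow> range (\<lambda>k::int. \<alpha> powi k) = UNIV - {0}"

definition cyclotomic_number :: "nat \<Rightarrow> 'a::finite_field \<Rightarrow> int \<Rightarrow> int \<Rightarrow> nat" where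
  "cyclotomic_number m \<alpha> a b =
     card ({\<alpha> powi k + 1 | k::int. [k = a] (mod int m)} \<inter>
           {\<alpha> powi k | k::int. [k = b] (mod int m)})"

definition cyclotomic_sum ::
  "nat \<Rightarrow> 'a::finite_field \<Rightarrow> 'b::finite_field \<Rightarrow> int \<Rightarrow> int \<Rightarrow> int \<Rightarrow> nat" (\<open>\<X>\<close>) where
  "\<X> m \<alpha>\<^sub>1 \<alpha>\<^sub>2 i j k =
     (\<Sum>a\<in>{0..int m - 1}. \<Sum>b\<in>{0..int m - 1}.
        cyclotomic_number m \<alpha>\<^sub>1 a b * cyclotomic_number m \<alpha>\<^sub>2 (a + i - j) (b + i - k))"

definition C1_set :: "'a::finite_field \<Rightarrow> ('a \<times> 'b::finite_field) set" where
  "C1_set \<alpha>\<^sub>1 = {(\<alpha>\<^sub>1 ^ k, 0) | k::nat. k \<le> CARD('a) - 2}"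

definition D_set :: "nat \<Rightarrow> 'a::finite_field \<Rightarrow> 'b::finite_field \<Rightarrow> int \<Rightarrow> ('a \<times> 'b) set" where
  "D_set m \<alpha>\<^sub>1 \<alpha>\<^sub>2 i =
     {(\<alpha>\<^sub>1 powi i\<^sub>1, \<alpha>\<^sub>2 powi i\<^sub>2) | i\<^sub>1 i\<^sub>2 :: int. [i\<^sub>1 - i\<^sub>2 = i] (mod int m)}"

text \<open>The Cayley digraph on the whole of the ambient additive group.\<close>
definition cayley_digraph :: "'g::ab_group_add set \<Rightarrow> 'g pair_pre_digraph" where
  "cayley_digraph S = \<lparr> pverts = UNIV, parcs = {(g, s + g) | g s. s \<in> S} \<rparr>"

definition Gamma_graph ::
  "nat \<Rightarrow> 'a::finite_field \<Rightarrow> 'b::finite_field \<Rightarrow> ('a \<times> 'b) pair_pre_digraph" where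
  "Gamma_graph m \<alpha>\<^sub>1 \<alpha>\<^sub>2 = cayley_digraph (C1_set \<alpha>\<^sub>1 \<union> D_set m \<alpha>\<^sub>1 \<alpha>\<^sub>2 0)"

text \<open>
  As in the \<^theory>\<open>Graph_Theory.Digraph\<close> library, an undirected simple graph is a finite, symmetric,
  loop-free digraph (\<^locale>\<open>pair_graph\<close>), an edge being a pair of opposite arcs.
\<close>
definition graph_clique :: "'v pair_pre_digraph \<Rightarrow> 'v set \<Rightarrow> bool" where
  "graph_clique G C \<longleftrightarrow>
     C \<subseteq> pverts G \<and> (\<forall>u\<in>C. \<forall>w\<in>C. u \<noteq> w \<longrightarrow> (u, w) \<in> parcs G)"

definition triangle :: "'v pair_pre_digraph \<Rightarrow> 'v set \<Rightarrow> bool" where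
  "triangle G T \<longleftrightarrow> graph_clique G T \<and> card T = 3"

definition edge_regular :: "'v pair_pre_digraph \<Rightarrow> nat \<Rightarrow> nat \<Rightarrow> nat \<Rightarrow> bool" where
  "edge_regular G v k l \<longleftrightarrow>
     pair_graph G \<and> card (pverts G) = v \<and>
     (\<forall>u\<in>pverts G. out_degree (with_proj G) u = k) \<and>
     (\<forall>(u, w)\<in>parcs G. card {T. triangle G T \<and> {u, w} \<subseteq> T} = l)"

definition regular_clique :: "'v pair_pre_digraph \<Rightarrow> nat \<Rightarrow> 'v set \<Rightarrow> bool" where
  "regular_clique G e C \<longleftrightarrow>
     graph_clique G C \<and> e > 0 \<and>
     (\<forall>u\<in>pverts G - C. card {w \<in> C. (u, w) \<in> parcs G} = e)"

definition neumaier_graph :: "'v pair_pre_digraph \<Rightarrow> bool" where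
  "neumaier_graph G \<longleftrightarrow>
     \<not> complete_digraph (card (pverts G)) (with_proj G) \<and>
     (\<exists>v k l. edge_regular G v k l) \<and> (\<exists>e C. regular_clique G e C)"

definition neumaier_parameters ::
  "'v pair_pre_digraph \<Rightarrow> nat \<Rightarrow> nat \<Rightarrow> nat \<Rightarrow> nat \<Rightarrow> nat \<Rightarrow> bool" where
  "neumaier_parameters G v k l e s \<longleftrightarrow>
     neumaier_graph G \<and> edge_regular G v k l \<and> (\<exists>C. regular_clique G e C \<and> card C = s)"

definition common_neighbours :: "'v pair_pre_digraph \<Rightarrow> 'v \<Rightarrow> 'v \<Rightarrow> 'v set" where
  "common_neighbours G u w = {x \<in> pverts G. (u, x) \<in> parcs G \<and> (w, x) \<in> parcs G}"

end

theory Submission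
  imports Defs
begin

text \<open>
  Write ind for the discrete logarithm modulo m. The neighbours of 0 are the points (x, y) with
  x \<noteq> 0 and either y = 0 or ind x = ind y. The graph is undirected iff ind (-1) is the same residue
  in both fields, which is a parity condition. The line y = 0 is always an n1-regular clique, so
  being Neumaier reduces to edge-regularity, that is, to the number of common neighbours of 0 and a
  neighbour d being constant. For d = (x, 0) this number is determined by the parameters; for
  d = (x, y) with y \<noteq> 0 the maps z \<mapsto> x / z and w \<mapsto> y / w turn the essential part
  of the count into a cyclotomic sum, and equating the two numbers gives the stated equation.
\<close>

section \<open>Indices in a finite field\<close>

text \<open>The value at 0 is junk: no power of the primitive element is 0.\<close>
definition cyc_index :: "nat \<Rightarrow> 'a::finite_field \<Rightarrow> 'a \<Rightarrow> int" where
  "cyc_index m \<alpha> x = (SOME k. \<alpha> powi k = x) mod int m"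

locale cyclotomic =
  fixes m n :: nat and \<alpha> :: "'a::finite_field"
  assumes m_pos: "0 < m" and n_pos: "0 < n"
    and card_field: "CARD('a) = 1 + m * n"
    and primitive: "primitive_element \<alpha>"
begin

abbreviation ind :: "'a \<Rightarrow> int" where "ind \<equiv> cyc_index m \<alpha>"

section \<open>Powers of the primitive element\<close>

lemma primitive_nz [simp]: "\<alpha> \<noteq> 0"
proof -
  have "\<alpha> powi 1 \<in> UNIV - {0}"
    using primitive unfolding primitive_element_def by blast
  then show ?thesis by simp
qed

lemma power_card_minus_one:
  fixes x :: 'a assumes "x \<noteq> 0" shows "x ^ (m * n) = 1"
proof -
  have "x * x ^ (m * n) = x * 1"
    using finite_field_power_card_eq_same[of x] by (simp add: card_field)
  then show ?thesis using assms by simp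
qed

lemma powi_mod: "\<alpha> powi (k mod int (m * n)) = \<alpha> powi k"
proof -
  have "\<alpha> powi k = \<alpha> powi (int (m * n) * (k div int (m * n)) + k mod int (m * n))"
    by simp
  also have "\<dots> = (\<alpha> ^ (m * n)) powi (k div int (m * n)) * \<alpha> powi (k mod int (m * n))"
    by (simp only: power_int_add[OF disjI1[OF primitive_nz]] power_int_mult power_int_of_nat)
  finally show ?thesis by (simp add: power_card_minus_one)
qed

text \<open>Primitivity gives surjectivity once exponents are reduced modulo \<open>m * n\<close>;
  injectivity then follows because both sides have \<open>m * n\<close> elements.\<close>

lemma bij_betw_powi: "bij_betw (\<lambda>k. \<alpha> powi k) {0..<int (m * n)} (UNIV - {0})"
proof -
  have "(\<lambda>k. \<alpha> powi k) ` {0..<int (m * n)} = UNIV - {0}" (is "?L = ?R")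
  proof
    show "?L \<subseteq> ?R" by auto
    show "?R \<subseteq> ?L"
    proof
      fix x :: 'a assume "x \<in> ?R"
      then obtain k :: int where "x = \<alpha> powi k"
        using primitive unfolding primitive_element_def by blast
      then have "x = \<alpha> powi (k mod int (m * n))" by (simp only: powi_mod)
      moreover have "k mod int (m * n) \<in> {0..<int (m * n)}"
        using m_pos n_pos by (simp del: of_nat_mult)
      ultimately show "x \<in> ?L" by blast
    qed
  qed
  moreover from this have "inj_on (\<lambda>k. \<alpha> powi k) {0..<int (m * n)}"
    by (intro eq_card_imp_inj_on) (simp_all add: card_Diff_singleton card_field del: of_nat_mult)
  ultimately show ?thesis by (simp add: bij_betw_def)
qed

lemma powi_eq_imp_cong:
  assumes "\<alpha> powi j = \<alpha> powi k"
  shows "[j = k] (mod int (m * n))"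
proof -
  have "j mod int (m * n) \<in> {0..<int (m * n)}" "k mod int (m * n) \<in> {0..<int (m * n)}"
    using m_pos n_pos by (simp_all del: of_nat_mult)
  moreover have "\<alpha> powi (j mod int (m * n)) = \<alpha> powi (k mod int (m * n))"
    using assms by (simp only: powi_mod)
  ultimately show ?thesis
    using bij_betw_powi unfolding bij_betw_def inj_on_def cong_def by blast
qed

text \<open>The arbitrary choice in \<open>cyc_index\<close> is harmless: two exponents of the same
  element agree modulo \<open>m * n\<close>, hence modulo \<open>m\<close>.\<close>

lemma ind_powi: "ind (\<alpha> powi k) = k mod int m"
proof -
  have "\<alpha> powi (SOME j. \<alpha> powi j = \<alpha> powi k) = \<alpha> powi k" by (rule someI) simp
  then have "[(SOME j. \<alpha> powi j = \<alpha> powi k) = k] (mod int m * int n)"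
    using powi_eq_imp_cong by simp
  then show ?thesis
    unfolding cyc_index_def using cong_modulus_mult unfolding cong_def by blast
qed

lemma nonzero_powiE:
  assumes "x \<noteq> 0" obtains k :: int where "x = \<alpha> powi k"
  using primitive assms unfolding primitive_element_def by blast

section \<open>The index as a homomorphism to the residues modulo m\<close>

lemma ind_range: "ind x \<in> {0..int m - 1}"
  unfolding cyc_index_def using m_pos by simp

lemma cong_ind_powi: "[ind (\<alpha> powi k) = k] (mod int m)"
  by (simp add: ind_powi)

lemma cong_ind_mult:
  assumes "x \<noteq> 0" "y \<noteq> 0"
  shows "[ind (x * y) = ind x + ind y] (mod int m)"
  using assms
  by (elim nonzero_powiE) (simp add: power_int_add[symmetric] ind_powi cong_def mod_simps)

lemma cong_ind_divide:
  assumes "x \<noteq> 0" "y \<noteq> 0"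
  shows "[ind (x / y) = ind x - ind y] (mod int m)"
  using assms
  by (elim nonzero_powiE) (simp add: power_int_diff[symmetric] ind_powi cong_def mod_simps)

lemma cong_ind_minus:
  assumes "x \<noteq> 0"
  shows "[ind (- x) = ind (- 1) + ind x] (mod int m)"
  using cong_ind_mult[of "- 1" x] assms by simp

lemma ind_one [simp]: "ind 1 = 0"
  using ind_powi[of 0] by simp

text \<open>Among the \<open>m * n\<close> exponents that represent the nonzero elements, every
  residue class modulo \<open>m\<close> occurs equally often; \<open>g\<close> enumerates the class
  of \<open>a\<close>.\<close>

lemma card_ind_class: "card {x. x \<noteq> 0 \<and> [ind x = a] (mod int m)} = n"
proof -
  define g where "g t = a mod int m + int m * t" for t
  have bij: "bij_betw g {0..<int n} {k \<in> {0..<int (m * n)}. [k = a] (mod int m)}"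
  proof (rule bij_betw_byWitness[where f' = "\<lambda>k. k div int m"])
    have r: "0 \<le> a mod int m" "a mod int m < int m" using m_pos by auto
    show "\<forall>t\<in>{0..<int n}. g t div int m = t"
      using m_pos r by (simp add: g_def)
    show "\<forall>k\<in>{k \<in> {0..<int (m * n)}. [k = a] (mod int m)}. g (k div int m) = k"
      by (simp add: g_def cong_def)  (metis mod_mult_div_eq)
    show "g ` {0..<int n} \<subseteq> {k \<in> {0..<int (m * n)}. [k = a] (mod int m)}"
    proof safe
      fix t assume t: "t \<in> {0..<int n}"
      \<comment> \<open>Bounding \<open>t\<close> by \<open>n - 1\<close> rather than
        \<open>n\<close> leaves room of size \<open>m\<close>, which absorbs the remainder of
        \<open>a\<close>.\<close>
      have "int m * t \<le> int m * (int n - 1)" using t m_pos by (intro mult_left_mono) auto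
      moreover have "0 \<le> int m * t" using t by simp
      ultimately show "g t \<in> {0..<int (m * n)}"
        using r unfolding g_def by (simp add: right_diff_distrib)
      show "[g t = a] (mod int m)" by (simp add: g_def cong_def)
    qed
    show "(\<lambda>k. k div int m) ` {k \<in> {0..<int (m * n)}. [k = a] (mod int m)} \<subseteq> {0..<int n}"
    proof safe
      fix k assume k: "k \<in> {0..<int (m * n)}"
      have "int m * (k div int m) \<le> k" using m_pos
        by (metis mult_div_mod_eq of_nat_0_less_iff pos_mod_sign le_add_same_cancel1)
      then have "int m * (k div int m) < int m * int n" using k by simp
      then show "k div int m \<in> {0..<int n}"
        using k m_pos by (simp add: pos_imp_zdiv_nonneg_iff)
    qed
  qed
  have "{x. x \<noteq> 0 \<and> [ind x = a] (mod int m)} =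
      (\<lambda>k. \<alpha> powi k) ` {k \<in> {0..<int (m * n)}. [k = a] (mod int m)}" (is "?L = ?R")
  proof
    show "?R \<subseteq> ?L" by (auto simp: ind_powi cong_def)
    show "?L \<subseteq> ?R"
    proof
      fix x assume x: "x \<in> ?L"
      then have "x \<in> (\<lambda>k. \<alpha> powi k) ` {0..<int (m * n)}"
        using bij_betw_imp_surj_on[OF bij_betw_powi] by simp
      then obtain k where "k \<in> {0..<int (m * n)}" "x = \<alpha> powi k" by blast
      then show "x \<in> ?R" using x by (auto simp: ind_powi cong_def)
    qed
  qed
  also have "card \<dots> = card {k \<in> {0..<int (m * n)}. [k = a] (mod int m)}"
    using bij_betw_powi by (intro card_image) (auto simp: bij_betw_def inj_on_def)
  also have "\<dots> = n"
    using bij_betw_same_card[OF bij] by simp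
  finally show ?thesis .
qed

text \<open>Writing a common element as u, membership in the two sets becomes a condition on the
  indices of u - 1 and u. The values 1 and 0 are excluded because there one of these indices is
  junk.\<close>

lemma cyclotomic_number_eq:
  "cyclotomic_number m \<alpha> a b =
     card {u. u \<noteq> 0 \<and> u \<noteq> 1 \<and> [ind (u - 1) = a] (mod int m) \<and> [ind u = b] (mod int m)}"
proof -
  have "{\<alpha> powi k + 1 | k::int. [k = a] (mod int m)} = {u. u \<noteq> 1 \<and> [ind (u - 1) = a] (mod int m)}"
    (is "?L = ?R")
  proof
    show "?L \<subseteq> ?R" by (auto simp: ind_powi cong_def)
    show "?R \<subseteq> ?L"
    proof
      fix u assume u: "u \<in> ?R"
      then obtain k where k: "u - 1 = \<alpha> powi k" using nonzero_powiE[of "u - 1"] by auto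
      then have "[k = a] (mod int m)" using u by (simp add: ind_powi cong_def)
      moreover have "u = \<alpha> powi k + 1" using k by (simp add: algebra_simps)
      ultimately show "u \<in> ?L" by blast
    qed
  qed
  moreover have "{\<alpha> powi k | k::int. [k = b] (mod int m)} = {u. u \<noteq> 0 \<and> [ind u = b] (mod int m)}"
    by (auto simp: ind_powi cong_def elim!: nonzero_powiE)
  moreover have "{u. u \<noteq> 1 \<and> [ind (u - 1) = a] (mod int m)} \<inter> {u. u \<noteq> 0 \<and> [ind u = b] (mod int m)} =
      {u. u \<noteq> 0 \<and> u \<noteq> 1 \<and> [ind (u - 1) = a] (mod int m) \<and> [ind u = b] (mod int m)}"
    by blast
  ultimately show ?thesis unfolding cyclotomic_number_def by simp
qed

text \<open>The Moebius map u \<mapsto> u / (u - 1) permutes the elements other than 0 and 1, so the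
  condition ind u = ind (u - 1) just says that the image has index 0.\<close>
lemma card_ind_consecutive:
  "card {u. u \<noteq> 0 \<and> u \<noteq> 1 \<and> [ind u = ind (u - 1)] (mod int m)} = n - 1"
proof -
  have iff: "[ind (u / (u - 1)) = 0] (mod int m) \<longleftrightarrow> [ind u = ind (u - 1)] (mod int m)"
    if "u \<noteq> 0" "u \<noteq> 1" for u
  proof -
    have "[ind (u / (u - 1)) = ind u - ind (u - 1)] (mod int m)"
      using that by (intro cong_ind_divide) auto
    then have "[ind (u / (u - 1)) = 0] (mod int m) \<longleftrightarrow> [ind u - ind (u - 1) = 0] (mod int m)"
      by (simp add: cong_def)
    then show ?thesis by (simp add: cong_diff_iff_cong_0)
  qed
  have inv: "u / (u - 1) / (u / (u - 1) - 1) = u" if "u \<noteq> 1" for u :: 'a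
  proof -
    have "u / (u - 1) - 1 = 1 / (u - 1)" using that by (simp add: field_simps)
    then show ?thesis using that by simp
  qed
  \<comment> \<open>The map is an involution. Its value is never 1, although 1 has index 0; this
    accounts for the one element missing from the class of size \<open>n\<close>.\<close>
  have bij: "bij_betw (\<lambda>u. u / (u - 1)) {u. u \<noteq> 0 \<and> u \<noteq> 1 \<and> [ind u = ind (u - 1)] (mod int m)}
      ({v. v \<noteq> 0 \<and> [ind v = 0] (mod int m)} - {1})" (is "bij_betw ?f ?A ?B")
  proof (rule bij_betw_byWitness[where f' = ?f])
    show "\<forall>a\<in>?A. ?f (?f a) = a" "\<forall>a\<in>?B. ?f (?f a) = a" using inv by auto
    show "?f ` ?A \<subseteq> ?B" using iff by (auto simp: field_simps)
    show "?f ` ?B \<subseteq> ?A"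
    proof safe
      fix v assume v: "v \<noteq> 0" "[ind v = 0] (mod int m)" "v \<noteq> 1"
      show "?f v = 0 \<Longrightarrow> False" using v by simp
      show "?f v = 1 \<Longrightarrow> False" using v by (simp add: field_simps)
      with v iff[of "?f v"] inv[of v] show "[ind (?f v) = ind (?f v - 1)] (mod int m)"
        by simp
    qed
  qed
  have "card ?A = card ?B" using bij_betw_same_card[OF bij] .
  also have "\<dots> = n - 1" using card_ind_class[of 0] by (subst card_Diff_singleton) auto
  finally show ?thesis .
qed

text \<open>Substituting z = x * u adds \<open>ind x\<close> to the indices of both u and u - 1,
  which reduces the count to the case x = 1.\<close>

lemma card_ind_shift:
  assumes "x \<noteq> 0"
  shows "card {z. z \<noteq> 0 \<and> z \<noteq> x \<and> [ind z = ind (z - x)] (mod int m)} = n - 1"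
proof -
  have "[ind (x * u) = ind (x * u - x)] (mod int m) \<longleftrightarrow> [ind u = ind (u - 1)] (mod int m)"
    if "u \<noteq> 0" "u \<noteq> 1" for u
  proof -
    have "x * u - x = x * (u - 1)" by (simp add: algebra_simps)
    then have "[ind (x * u) = ind (x * u - x)] (mod int m) \<longleftrightarrow>
        [ind x + ind u = ind x + ind (u - 1)] (mod int m)"
      using cong_ind_mult[of x u] cong_ind_mult[of x "u - 1"] assms that by (simp add: cong_def)
    then show ?thesis by (simp add: cong_add_lcancel)
  qed
  note scale = this
  have "[ind (z / x) = ind (z / x - 1)] (mod int m) \<longleftrightarrow> [ind z = ind (z - x)] (mod int m)"
    if "z \<noteq> 0" "z \<noteq> x" for z
    using scale[of "z / x"] that assms by simp
  then have "bij_betw (\<lambda>u. x * u) {u. u \<noteq> 0 \<and> u \<noteq> 1 \<and> [ind u = ind (u - 1)] (mod int m)}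
      {z. z \<noteq> 0 \<and> z \<noteq> x \<and> [ind z = ind (z - x)] (mod int m)}"
    using assms by (intro bij_betw_byWitness[where f' = "\<lambda>z. z / x"]) (auto simp: scale)
  then show ?thesis using card_ind_consecutive by (simp add: bij_betw_same_card)
qed

text \<open>If \<open>m * n\<close> is odd, then -1 = 1 has index 0, and \<open>1 + m * n\<close> is
  even. Otherwise -1 is \<alpha> to the power \<open>m * n div 2\<close>, so its index vanishes iff
  \<open>m\<close> divides this exponent, that is, iff \<open>n\<close> is even; here
  \<open>1 + m * n\<close> is odd.\<close>

lemma cong_ind_minus_one_iff: "[ind (- 1) = 0] (mod int m) \<longleftrightarrow> even ((1 + m * n) * n)"
proof (cases "even (m * n)")
  case False
  have "(- 1 :: 'a) = 1" using power_card_minus_one[of "- 1 :: 'a"] False by simp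
  then have "ind (- 1) = ind 1" by (rule arg_cong)
  then show ?thesis using False by simp
next
  case True
  define k where "k = m * n div 2"
  have k: "m * n = 2 * k" using True by (simp add: k_def)
  have "(\<alpha> powi int k) ^ 2 = 1"
    using power_card_minus_one[of \<alpha>] by (simp add: k power_mult mult.commute)
  \<comment> \<open>The positive number \<open>k\<close> is half of \<open>m * n\<close>, so
    \<open>m * n\<close> cannot divide it. This leaves -1 as the square root of 1 in
    question.\<close>
  moreover have "\<alpha> powi int k \<noteq> 1"
  proof
    assume "\<alpha> powi int k = 1"
    then have "[int k = 0] (mod int (m * n))" using powi_eq_imp_cong[of "int k" 0] by simp
    then have "m * n dvd k" by (simp add: cong_0_iff flip: of_nat_mult)
    then show False using k m_pos n_pos by (auto dest: dvd_imp_le)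
  qed
  ultimately have "\<alpha> powi int k = - 1" by (simp add: power2_eq_1_iff)
  then have "[ind (- 1) = int k] (mod int m)" using cong_ind_powi[of "int k"] by simp
  then have "[ind (- 1) = 0] (mod int m) \<longleftrightarrow> m dvd k"
    by (metis cong_0_iff cong_sym cong_trans int_dvd_int_iff)
  also have "\<dots> \<longleftrightarrow> 2 * m dvd 2 * k" by simp
  also have "\<dots> \<longleftrightarrow> m * 2 dvd m * n" by (simp add: k mult.commute)
  also have "\<dots> \<longleftrightarrow> even n" using m_pos by simp
  also have "\<dots> \<longleftrightarrow> even ((1 + m * n) * n)" using True by simp
  finally show ?thesis .
qed

lemma cong_double_ind_minus_one: "[2 * ind (- 1) = 0] (mod int m)"
  using cong_ind_mult[of "- 1" "- 1"] by (simp add: cong_sym_eq)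

end

section \<open>Cayley graphs\<close>

text \<open>The Cayley digraph is then loop-free and symmetric, so over a finite group it is an
  undirected simple graph.\<close>

definition symmetric_connection :: "'g::ab_group_add set \<Rightarrow> bool" where
  "symmetric_connection S \<longleftrightarrow> 0 \<notin> S \<and> (\<forall>s\<in>S. - s \<in> S)"

lemma pverts_cayley [simp]: "pverts (cayley_digraph S) = UNIV"
  by (simp add: cayley_digraph_def)

lemma parcs_cayley_iff [simp]: "(u, w) \<in> parcs (cayley_digraph S) \<longleftrightarrow> w - u \<in> S"
proof -
  have "(u, w) \<in> {(g, s + g) | g s. s \<in> S} \<longleftrightarrow> (\<exists>s\<in>S. w = s + u)" by blast
  also have "\<dots> \<longleftrightarrow> w - u \<in> S" by (metis add_diff_cancel_right' diff_add_cancel)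
  finally show ?thesis by (simp add: cayley_digraph_def)
qed

lemma pair_graph_cayley_iff:
  fixes S :: "'g::{ab_group_add,finite} set"
  shows "pair_graph (cayley_digraph S) \<longleftrightarrow> symmetric_connection S"
proof
  assume "pair_graph (cayley_digraph S)"
  then interpret pair_graph "cayley_digraph S" .
  have "0 \<notin> S" using pair_no_loops[of "(0, 0)"] by auto
  moreover have "- s \<in> S" if "s \<in> S" for s
    using arcs_symmetric[of 0 s] that by simp
  ultimately show "symmetric_connection S" by (simp add: symmetric_connection_def)
next
  assume S: "symmetric_connection S"
  have "w - u \<in> S \<Longrightarrow> u - w \<in> S" for u w
    using S minus_diff_eq[of w u] unfolding symmetric_connection_def by metis
  then have "symmetric (cayley_digraph S :: 'g pair_pre_digraph)"
    by (auto simp: symmetric_def sym_def)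
  with S show "pair_graph (cayley_digraph S)"
    by unfold_locales (auto simp: symmetric_connection_def)
qed

lemma out_degree_cayley: "out_degree (with_proj (cayley_digraph S)) u = card S"
proof -
  have "out_arcs (with_proj (cayley_digraph S)) u = (\<lambda>s. (u, s + u)) ` S"
    by (auto simp: out_arcs_def image_iff) (metis diff_add_cancel)
  then show ?thesis
    unfolding out_degree_def by (simp add: card_image inj_on_def)
qed

text \<open>Translation by \<open>- u\<close> moves the pair to 0 and \<open>w - u\<close>, so the
  count depends only on the difference.\<close>

lemma card_common_neighbours_cayley:
  "card (common_neighbours (cayley_digraph S) u w) = card {s \<in> S. s - (w - u) \<in> S}"
proof -
  have "common_neighbours (cayley_digraph S) u w = (\<lambda>s. s + u) ` {s \<in> S. s - (w - u) \<in> S}"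
    (is "?L = ?f ` ?R")
  proof
    show "?f ` ?R \<subseteq> ?L" by (auto simp: common_neighbours_def algebra_simps)
    show "?L \<subseteq> ?f ` ?R"
    proof
      fix x assume "x \<in> ?L"
      then have "x - u \<in> ?R" by (simp add: common_neighbours_def)
      moreover have "x = ?f (x - u)" by simp
      ultimately show "x \<in> ?f ` ?R" by blast
    qed
  qed
  then show ?thesis by (simp add: card_image)
qed

text \<open>A triangle through the edge is determined by its third vertex. Absence of loops makes
  every common neighbour distinct from \<open>u\<close> and \<open>w\<close>, and symmetry supplies
  the reverse arcs.\<close>

lemma (in pair_graph) card_triangles:
  assumes "(u, w) \<in> parcs G"
  shows "card {T. triangle G T \<and> {u, w} \<subseteq> T} = card (common_neighbours G u w)"
proof -
  have uw: "u \<noteq> w" "(w, u) \<in> parcs G" "u \<in> pverts G" "w \<in> pverts G"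
    using assms no_loops' arcs_symmetric in_arcsD1 in_arcsD2 by blast+
  have nb: "x \<noteq> u" "x \<noteq> w" if "x \<in> common_neighbours G u w" for x
    using that no_loops' by (auto simp: common_neighbours_def)
  have "{T. triangle G T \<and> {u, w} \<subseteq> T} = (\<lambda>x. {u, w, x}) ` common_neighbours G u w" (is "?L = ?R")
  proof
    show "?R \<subseteq> ?L"
    proof safe
      fix x assume x: "x \<in> common_neighbours G u w"
      then have "(x, u) \<in> parcs G" "(x, w) \<in> parcs G"
        using arcs_symmetric by (auto simp: common_neighbours_def)
      then show "triangle G {u, w, x}"
        using x nb[OF x] uw assms by (auto simp: common_neighbours_def triangle_def graph_clique_def)
    qed
    show "?L \<subseteq> ?R"
    proof
      fix T assume T: "T \<in> ?L"
      then have "card (T - {u, w}) = 1"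
        using uw by (subst card_Diff_subset) (auto simp: triangle_def)
      then obtain x where x: "T - {u, w} = {x}" by (auto simp: card_1_singleton_iff)
      then have "T = {u, w, x}" "x \<noteq> u" "x \<noteq> w" using T by auto
      moreover from this have "x \<in> common_neighbours G u w"
        using T by (auto simp: common_neighbours_def triangle_def graph_clique_def)
      ultimately show "T \<in> ?R" by blast
    qed
  qed
  moreover have "inj_on (\<lambda>x. {u, w, x}) (common_neighbours G u w)"
    using nb by (intro inj_onI) (auto simp: insert_eq_iff doubleton_eq_iff)
  ultimately show ?thesis by (simp add: card_image)
qed

lemma edge_regular_cayley_iff:
  fixes S :: "'g::{ab_group_add,finite} set"
  shows "edge_regular (cayley_digraph S) v k l \<longleftrightarrow>
    symmetric_connection S \<and> v = CARD('g) \<and> k = card S \<and> (\<forall>d\<in>S. card {s \<in> S. s - d \<in> S} = l)"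
proof (cases "symmetric_connection S")
  case True
  then interpret pair_graph "cayley_digraph S" by (simp add: pair_graph_cayley_iff)
  have "card {T. triangle (cayley_digraph S) T \<and> {u, w} \<subseteq> T} = card {s \<in> S. s - (w - u) \<in> S}"
    if "(u, w) \<in> parcs (cayley_digraph S)" for u w
    using card_triangles[OF that] by (simp only: card_common_neighbours_cayley)
  then have "(\<forall>(u, w)\<in>parcs (cayley_digraph S). card {T. triangle (cayley_digraph S) T \<and> {u, w} \<subseteq> T} = l)
     \<longleftrightarrow> (\<forall>(u, w)\<in>parcs (cayley_digraph S). card {s \<in> S. s - (w - u) \<in> S} = l)"
    by (intro ball_cong refl) (simp only: split_paired_all prod.case)
  also have "\<dots> \<longleftrightarrow> (\<forall>d\<in>S. card {s \<in> S. s - d \<in> S} = l)"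
  proof
    assume *: "\<forall>(u, w)\<in>parcs (cayley_digraph S). card {s \<in> S. s - (w - u) \<in> S} = l"
    show "\<forall>d\<in>S. card {s \<in> S. s - d \<in> S} = l"
      \<comment> \<open>The arcs leaving 0 already realise every difference in
        \<open>S\<close>.\<close>
      using bspec[OF *, of "(0, _)"] by simp
  qed auto
  finally show ?thesis
    using True by (auto simp: edge_regular_def out_degree_cayley pair_graph_cayley_iff)
qed (simp add: edge_regular_def pair_graph_cayley_iff)

section \<open>The connection set\<close>

lemma card_Collect_pairs_const:
  fixes P :: "'a::finite \<Rightarrow> 'b::finite \<Rightarrow> bool"
  assumes "\<And>x. Q x \<Longrightarrow> card {y. P x y} = n"
  shows "card {(x, y). Q x \<and> P x y} = card {x. Q x} * n"
proof -
  have "{(x, y). Q x \<and> P x y} = Sigma {x. Q x} (\<lambda>x. {y. P x y})" by auto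
  then show ?thesis using assms by simp
qed

lemma cong_add_cancel_cong:
  fixes a b c d m :: int
  assumes "[a = b] (mod m)"
  shows "[a + c = b + d] (mod m) \<longleftrightarrow> [c = d] (mod m)"
proof -
  have "a + c - (b + d) = (a - b) + (c - d)" by simp
  then show ?thesis using assms dvd_add_right_iff[of m "a - b" "c - d"]
    by (simp only: cong_iff_dvd_diff)
qed

locale cyclotomic_pair =
  F1: cyclotomic m n\<^sub>1 \<alpha>\<^sub>1 + F2: cyclotomic m n\<^sub>2 \<alpha>\<^sub>2
  for m n\<^sub>1 n\<^sub>2 :: nat and \<alpha>\<^sub>1 :: "'a::finite_field" and \<alpha>\<^sub>2 :: "'b::finite_field"
begin

text \<open>For nonzero arguments this is membership in \<open>D_set\<close> at 0. The index of 0 is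
  junk, but the class counts below hold for any value of the fixed argument.\<close>

definition same :: "'a \<Rightarrow> 'b \<Rightarrow> bool" where
  "same x y \<longleftrightarrow> [F1.ind x = F2.ind y] (mod int m)"

definition conn :: "('a \<times> 'b) set" where
  "conn = C1_set \<alpha>\<^sub>1 \<union> D_set m \<alpha>\<^sub>1 \<alpha>\<^sub>2 0"

lemma C1_set_eq: "C1_set \<alpha>\<^sub>1 = {(x, 0 :: 'b) | x. x \<noteq> 0}" (is "?L = ?R")
proof
  show "?L \<subseteq> ?R"
  proof
    fix p :: "'a \<times> 'b" assume "p \<in> ?L"
    then obtain k :: nat where "p = (\<alpha>\<^sub>1 ^ k, 0)" unfolding C1_set_def by blast
    then show "p \<in> ?R" by simp
  qed
  show "?R \<subseteq> ?L"
  proof safe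
    fix x :: 'a assume "x \<noteq> 0"
    then have "x \<in> (\<lambda>k. \<alpha>\<^sub>1 powi k) ` {0..<int (m * n\<^sub>1)}"
      using bij_betw_imp_surj_on[OF F1.bij_betw_powi] by simp
    then obtain k where k: "k \<in> {0..<int (m * n\<^sub>1)}" "x = \<alpha>\<^sub>1 powi k" by blast
    have "x = \<alpha>\<^sub>1 ^ nat k" using k by (simp add: power_int_nonneg_exp)
    moreover have "nat k < m * n\<^sub>1" using k(1) by (simp add: nat_less_iff)
    then have "nat k \<le> CARD('a) - 2" unfolding F1.card_field by linarith
    ultimately show "(x, 0) \<in> C1_set \<alpha>\<^sub>1" unfolding C1_set_def by blast
  qed
qed

lemma D_set_0_iff: "(x, y) \<in> D_set m \<alpha>\<^sub>1 \<alpha>\<^sub>2 0 \<longleftrightarrow> x \<noteq> 0 \<and> y \<noteq> 0 \<and> same x y"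
proof
  assume "(x, y) \<in> D_set m \<alpha>\<^sub>1 \<alpha>\<^sub>2 0"
  then show "x \<noteq> 0 \<and> y \<noteq> 0 \<and> same x y"
    by (auto simp: D_set_def same_def F1.ind_powi F2.ind_powi cong_diff_iff_cong_0)
next
  assume *: "x \<noteq> 0 \<and> y \<noteq> 0 \<and> same x y"
  then obtain j k where "x = \<alpha>\<^sub>1 powi j" "y = \<alpha>\<^sub>2 powi k"
    using F1.nonzero_powiE F2.nonzero_powiE by metis
  with * show "(x, y) \<in> D_set m \<alpha>\<^sub>1 \<alpha>\<^sub>2 0"
    unfolding D_set_def by (auto simp: same_def F1.ind_powi F2.ind_powi cong_diff_iff_cong_0)
qed

lemma conn_iff: "(x, y) \<in> conn \<longleftrightarrow> x \<noteq> 0 \<and> (y = 0 \<or> same x y)"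
  by (auto simp: conn_def C1_set_eq D_set_0_iff)

lemma zero_notin_conn [simp]: "0 \<notin> conn"
  by (simp add: zero_prod_def conn_iff)

lemma card_same_right: "card {y. y \<noteq> 0 \<and> same x y} = n\<^sub>2"
  using F2.card_ind_class[of "F1.ind x"] by (simp add: same_def cong_sym_eq)

lemma card_same_left: "card {x. x \<noteq> 0 \<and> same x y} = n\<^sub>1"
  using F1.card_ind_class[of "F2.ind y"] by (simp add: same_def)

lemma card_same_left_except:
  "card {z. z \<noteq> 0 \<and> z \<noteq> x \<and> same z y} = (if x \<noteq> 0 \<and> same x y then n\<^sub>1 - 1 else n\<^sub>1)"
proof -
  have "{z. z \<noteq> 0 \<and> z \<noteq> x \<and> same z y} = {z. z \<noteq> 0 \<and> same z y} - {x}" by auto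
  then show ?thesis using card_same_left[of y] by (auto simp: card_Diff_singleton_if)
qed

lemma card_nonzero: "card {x::'a. x \<noteq> 0} = m * n\<^sub>1"
  using F1.card_field by (simp add: Collect_neg_eq Compl_eq_Diff_UNIV card_Diff_singleton)

lemma card_conn: "card conn = m * n\<^sub>1 * (n\<^sub>2 + 1)"
proof -
  have "conn = {(x, y). x \<noteq> 0 \<and> (y = 0 \<or> same x y)}" by (auto simp: conn_iff)
  moreover have "card {y. y = 0 \<or> same x y} = n\<^sub>2 + 1" for x
  proof -
    have "{y. y = 0 \<or> same x y} = insert 0 {y. y \<noteq> 0 \<and> same x y}" by auto
    then show ?thesis using card_same_right[of x] by simp
  qed
  ultimately show ?thesis
    using card_Collect_pairs_const[of "\<lambda>x. x \<noteq> 0" "\<lambda>x y. y = 0 \<or> same x y" "n\<^sub>2 + 1"] card_nonzero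
    by simp
qed

section \<open>Negation and undirectedness\<close>

lemma same_minus_iff:
  assumes "[F1.ind (- 1) = F2.ind (- 1)] (mod int m)" "x \<noteq> 0" "y \<noteq> 0"
  shows "same (- x) (- y) \<longleftrightarrow> same x y"
proof -
  have "same (- x) (- y) \<longleftrightarrow> [F1.ind (- 1) + F1.ind x = F2.ind (- 1) + F2.ind y] (mod int m)"
    using F1.cong_ind_minus F2.cong_ind_minus assms(2,3) by (simp add: same_def cong_def)
  also have "\<dots> \<longleftrightarrow> [F1.ind (- 1) + F1.ind x = F1.ind (- 1) + F2.ind y] (mod int m)"
    using cong_add[OF assms(1) cong_refl[of "F2.ind y"]] by (simp add: cong_def)
  finally show ?thesis by (simp add: same_def cong_add_lcancel)
qed

text \<open>The element (1, 1) shows necessity. Conversely, negation shifts the two indices by the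
  same amount and so preserves \<open>same\<close>, and points with second coordinate 0 are closed
  under it.\<close>

lemma symmetric_connection_iff:
  "symmetric_connection conn \<longleftrightarrow> [F1.ind (- 1) = F2.ind (- 1)] (mod int m)"
proof
  assume S: "symmetric_connection conn"
  have "(1, 1) \<in> conn" by (simp add: conn_iff same_def)
  then have "- (1, 1) \<in> conn" using S unfolding symmetric_connection_def by blast
  then show "[F1.ind (- 1) = F2.ind (- 1)] (mod int m)" by (simp add: conn_iff same_def)
next
  assume minus: "[F1.ind (- 1) = F2.ind (- 1)] (mod int m)"
  have "(- x, - y) \<in> conn" if "(x, y) \<in> conn" for x y
    using that same_minus_iff[OF minus, of x y] by (cases "y = 0") (auto simp: conn_iff)
  then show "symmetric_connection conn"
    by (auto simp: symmetric_connection_def)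
qed

text \<open>Each index of -1 is killed by 2, and there is at most one nonzero such residue modulo m.\<close>
lemma ind_minus_one_cong_iff_parity:
  "[F1.ind (- 1) = F2.ind (- 1)] (mod int m) \<longleftrightarrow>
    [(1 + m * n\<^sub>1) * n\<^sub>1 = (1 + m * n\<^sub>2) * n\<^sub>2] (mod 2)"
proof -
  have half: "e = 0 \<or> 2 * e = int m"
    if e: "e \<in> {0..int m - 1}" "[2 * e = 0] (mod int m)" for e
  proof -
    obtain k where k: "2 * e = int m * k" using e(2) by (auto simp: cong_0_iff)
    have "int m * k < int m * 2" "0 \<le> int m * k" using e(1) by (simp_all flip: k)
    then have "k < 2" "0 \<le> k"
      using F1.m_pos mult_less_cancel_left_pos[of "int m" k 2] by (auto simp: zero_le_mult_iff)
    then have "k = 0 \<or> k = 1" by auto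
    then show ?thesis using k by auto
  qed
  have zero: "[e = 0] (mod int m) \<longleftrightarrow> e = 0" if "e \<in> {0..int m - 1}" for e
    using that by (auto simp: cong_def)
  have eq: "[e = f] (mod int m) \<longleftrightarrow> e = f" if "e \<in> {0..int m - 1}" "f \<in> {0..int m - 1}" for e f
    using that by (auto simp: cong_def)
  have "[F1.ind (- 1) = F2.ind (- 1)] (mod int m) \<longleftrightarrow> (F1.ind (- 1) = 0 \<longleftrightarrow> F2.ind (- 1) = 0)"
    using half[OF F1.ind_range F1.cong_double_ind_minus_one]
      half[OF F2.ind_range F2.cong_double_ind_minus_one] eq[OF F1.ind_range F2.ind_range] by auto
  also have "\<dots> \<longleftrightarrow> (even ((1 + m * n\<^sub>1) * n\<^sub>1) \<longleftrightarrow> even ((1 + m * n\<^sub>2) * n\<^sub>2))"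
    using F1.cong_ind_minus_one_iff F2.cong_ind_minus_one_iff
      zero[OF F1.ind_range] zero[OF F2.ind_range] by simp
  also have "\<dots> \<longleftrightarrow> [(1 + m * n\<^sub>1) * n\<^sub>1 = (1 + m * n\<^sub>2) * n\<^sub>2] (mod 2)"
    unfolding cong_def by (simp only: mod_2_eq_odd) auto
  finally show ?thesis .
qed

section \<open>Counting common neighbours\<close>

text \<open>Sort the pairs by the labels a = ind (u - 1) and b = ind u. Each fibre is a product of a
  set of u and a set of w, whose sizes are the two cyclotomic numbers; the shift by \<open>i\<close>
  replaces b by b - i for w.\<close>

lemma cyclotomic_sum_eq:
  "\<X> m \<alpha>\<^sub>1 \<alpha>\<^sub>2 0 0 i = card {(u, w). u \<noteq> 0 \<and> u \<noteq> 1 \<and> w \<noteq> 0 \<and> w \<noteq> 1 \<and>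
      same (u - 1) (w - 1) \<and> [F1.ind u = F2.ind w + i] (mod int m)}" (is "_ = card ?P")
proof -
  let ?I = "{0..int m - 1}"
  define A where "A = (\<lambda>(a, b). {u. u \<noteq> 0 \<and> u \<noteq> 1 \<and>
      [F1.ind (u - 1) = a] (mod int m) \<and> [F1.ind u = b] (mod int m)})"
  define B where "B = (\<lambda>(a, b). {w. w \<noteq> 0 \<and> w \<noteq> 1 \<and>
      [F2.ind (w - 1) = a] (mod int m) \<and> [F2.ind w = b - i] (mod int m)})"
  have shift: "[s = b - i] (mod int m) \<longleftrightarrow> [b = s + i] (mod int m)" for s b
  proof -
    have "[s = b - i] (mod int m) \<longleftrightarrow> [s + i = b - i + i] (mod int m)"
      by (simp only: cong_add_rcancel)
    then show ?thesis by (simp add: cong_sym_eq)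
  qed
  have "?P = (\<Union>p\<in>?I \<times> ?I. A p \<times> B p)"
  proof (intro equalityI subrelI)
    fix u w
    assume "(u, w) \<in> ?P"
    then have *: "u \<noteq> 0" "u \<noteq> 1" "w \<noteq> 0" "w \<noteq> 1" "same (u - 1) (w - 1)"
      "[F1.ind u = F2.ind w + i] (mod int m)"
      by auto
    then have "(u, w) \<in> A (F1.ind (u - 1), F1.ind u) \<times> B (F1.ind (u - 1), F1.ind u)"
      unfolding A_def B_def by (simp add: shift same_def cong_sym_eq)
    moreover have "(F1.ind (u - 1), F1.ind u) \<in> ?I \<times> ?I" using F1.ind_range by blast
    ultimately show "(u, w) \<in> (\<Union>p\<in>?I \<times> ?I. A p \<times> B p)" by blast
  next
    fix u w
    assume "(u, w) \<in> (\<Union>p\<in>?I \<times> ?I. A p \<times> B p)"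
    then obtain a b where *: "u \<in> A (a, b)" "w \<in> B (a, b)" by auto
    then have "[F1.ind (u - 1) = F2.ind (w - 1)] (mod int m)"
      by (simp add: A_def B_def cong_def)
    moreover have "[F1.ind u = F2.ind w + i] (mod int m)"
      using * unfolding A_def B_def by (simp add: shift) (metis cong_trans)
    ultimately show "(u, w) \<in> ?P"
      using * by (simp add: A_def B_def same_def)
  qed
  moreover have "card (\<Union>p\<in>?I \<times> ?I. A p \<times> B p) = (\<Sum>p\<in>?I \<times> ?I. card (A p \<times> B p))"
  proof (rule card_UN_disjoint)
    \<comment> \<open>Congruent members of \<open>?I\<close> are equal, so u alone determines the
      label.\<close>
    show "\<forall>p\<in>?I \<times> ?I. \<forall>p'\<in>?I \<times> ?I. p \<noteq> p' \<longrightarrow> A p \<times> B p \<inter> A p' \<times> B p' = {}"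
      by (auto simp: A_def cong_def)
  qed auto
  moreover have "card (A p) = cyclotomic_number m \<alpha>\<^sub>1 (fst p) (snd p)"
      "card (B p) = cyclotomic_number m \<alpha>\<^sub>2 (fst p + 0 - 0) (snd p + 0 - i)" for p
    unfolding A_def B_def F1.cyclotomic_number_eq F2.cyclotomic_number_eq by (auto simp: case_prod_beta)
  ultimately show ?thesis
    unfolding cyclotomic_sum_def by (simp add: card_cartesian_product sum.cartesian_product case_prod_beta)
qed

text \<open>The number of common neighbours of 0 and \<open>d\<close>, and by translation of any two
  vertices \<open>u\<close> and \<open>w\<close> with \<open>w - u = d\<close>.\<close>

definition common :: "'a \<times> 'b \<Rightarrow> nat" where
  "common d = card {s \<in> conn. s - d \<in> conn}"

text \<open>On the axis every point except 0 and x counts. Off the axis the index of the second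
  coordinate must equal those of both z and z - x, leaving \<open>n\<^sub>1 - 1\<close> choices for
  z and then \<open>n\<^sub>2\<close> for the second coordinate.\<close>

lemma common_C1:
  assumes "x \<noteq> 0"
  shows "common (x, 0) = m * n\<^sub>1 - 1 + (n\<^sub>1 - 1) * n\<^sub>2"
proof -
  let ?Q = "\<lambda>z. z \<noteq> 0 \<and> z \<noteq> x \<and> [F1.ind z = F1.ind (z - x)] (mod int m)"
  let ?A = "(\<lambda>z. (z, 0::'b)) ` ({z. z \<noteq> 0} - {x})" and ?B = "{(z, y). ?Q z \<and> (y \<noteq> 0 \<and> same z y)}"
  have "{s \<in> conn. s - (x, 0) \<in> conn} = ?A \<union> ?B"
    by (auto simp: conn_iff same_def cong_def)
  moreover have "card ?A = m * n\<^sub>1 - 1"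
    using assms by (simp add: card_image inj_on_def card_nonzero)
  moreover have "card ?B = (n\<^sub>1 - 1) * n\<^sub>2"
    by (subst card_Collect_pairs_const[OF card_same_right]) (simp add: F1.card_ind_shift assms)
  moreover have "?A \<inter> ?B = {}" by auto
  ultimately show ?thesis
    unfolding common_def by (simp add: card_Un_disjoint)
qed

text \<open>Split by whether the second coordinate of s, that of s - d, or neither is 0; the first
  two exclude each other as \<open>y\<close> is nonzero. Each of them runs through an index class,
  the only possible losses being s = 0 and s = d.\<close>

lemma common_decompose:
  assumes "y \<noteq> 0"
  shows "common (x, y) =
    (if x \<noteq> 0 \<and> same (- x) (- y) then n\<^sub>1 - 1 else n\<^sub>1) +
    (if x \<noteq> 0 \<and> same x y then n\<^sub>1 - 1 else n\<^sub>1) +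
    card {(z, w). z \<noteq> 0 \<and> z \<noteq> x \<and> w \<noteq> 0 \<and> w \<noteq> y \<and> same z w \<and> same (z - x) (w - y)}"
    (is "_ = ?a + ?b + card ?C")
proof -
  let ?A = "(\<lambda>z. (z + x, 0::'b)) ` {z. z \<noteq> 0 \<and> z \<noteq> - x \<and> same z (- y)}"
  let ?B = "(\<lambda>z. (z, y)) ` {z. z \<noteq> 0 \<and> z \<noteq> x \<and> same z y}"
  have A: "?A = {(z, w). z \<noteq> 0 \<and> z \<noteq> x \<and> w = 0 \<and> same (z - x) (- y)}" (is "_ = ?A'")
  proof (intro equalityI subsetI)
    fix p assume "p \<in> ?A'"
    then have "p = (fst p - x + x, 0)" "fst p - x \<in> {z. z \<noteq> 0 \<and> z \<noteq> - x \<and> same z (- y)}"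
      by auto
    then show "p \<in> ?A" by blast
  qed (auto simp: add_eq_0_iff2)
  have "{s \<in> conn. s - (x, y) \<in> conn} = ?A \<union> ?B \<union> ?C"
    unfolding A using assms by (auto simp: conn_iff)
  moreover have "card ?A = ?a"
    using card_same_left_except[of "- x" "- y"] by (simp add: card_image inj_on_def)
  moreover have "card ?B = ?b"
    using card_same_left_except[of x y] by (simp add: card_image inj_on_def)
  moreover have "?A \<inter> ?B = {}" "(?A \<union> ?B) \<inter> ?C = {}" using assms by auto
  ultimately show ?thesis
    unfolding common_def by (simp add: card_Un_disjoint)
qed

text \<open>Here s and s - d share their first coordinate, so w and w - y have equal indices: there
  are \<open>n\<^sub>2 - 1\<close> choices for w, then \<open>n\<^sub>1\<close> for z. The two axis
  terms contribute \<open>n\<^sub>1\<close> each.\<close>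

lemma common_vertical:
  assumes "y \<noteq> 0"
  shows "common (0, y) = n\<^sub>1 * (n\<^sub>2 + 1)"
proof -
  let ?C = "{(z, w). z \<noteq> 0 \<and> z \<noteq> 0 \<and> w \<noteq> 0 \<and> w \<noteq> y \<and> same z w \<and> same (z - 0) (w - y)}"
  let ?Q = "\<lambda>w. w \<noteq> 0 \<and> w \<noteq> y \<and> [F2.ind w = F2.ind (w - y)] (mod int m)"
  have "?C = prod.swap ` {(w, z). ?Q w \<and> (z \<noteq> 0 \<and> same z w)}"
    by (auto simp: same_def cong_def image_iff)
  then have "card ?C = card {(w, z). ?Q w \<and> (z \<noteq> 0 \<and> same z w)}"
    by (simp only: card_image inj_swap)
  also have "\<dots> = (n\<^sub>2 - 1) * n\<^sub>1"
    by (subst card_Collect_pairs_const[OF card_same_left]) (simp add: F2.card_ind_shift assms)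
  finally show ?thesis
    unfolding common_decompose[OF assms]
    using F2.n_pos by (cases n\<^sub>2) (simp_all add: algebra_simps)
qed

text \<open>Inverting both coordinates turns the simultaneous index shift of u and u - 1 by i
  into a shift of u alone, which is the shape of the third index of the cyclotomic sum.\<close>
lemma card_shifted_pairs:
  assumes minus: "[F1.ind (- 1) = F2.ind (- 1)] (mod int m)"
    and xy: "x \<noteq> 0" "y \<noteq> 0" and i: "[F1.ind x - F2.ind y = i] (mod int m)"
  shows "card {(z, w). z \<noteq> 0 \<and> z \<noteq> x \<and> w \<noteq> 0 \<and> w \<noteq> y \<and> same z w \<and> same (z - x) (w - y)} =
    \<X> m \<alpha>\<^sub>1 \<alpha>\<^sub>2 0 0 i" (is "card ?C = _")
proof -
  let ?P = "{(u, w). u \<noteq> 0 \<and> u \<noteq> 1 \<and> w \<noteq> 0 \<and> w \<noteq> 1 \<and>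
      same (u - 1) (w - 1) \<and> [F1.ind u = F2.ind w + i] (mod int m)}"
  have iff: "same (x / u) (y / w) \<and> same (x / u - x) (y / w - y) \<longleftrightarrow>
      same (u - 1) (w - 1) \<and> [F1.ind u = F2.ind w + i] (mod int m)"
    if uw: "u \<noteq> 0" "u \<noteq> 1" "w \<noteq> 0" "w \<noteq> 1" for u w
  proof -
    have "[F1.ind (x / u) = F1.ind x - F1.ind u] (mod int m)"
      "[F2.ind (y / w) = F2.ind y - F2.ind w] (mod int m)"
      using F1.cong_ind_divide F2.cong_ind_divide uw xy by auto
    then have "same (x / u) (y / w) \<longleftrightarrow> [F1.ind x - F1.ind u = F2.ind y - F2.ind w] (mod int m)"
      by (simp add: same_def cong_def)
    also have "\<dots> \<longleftrightarrow> [F1.ind u = F2.ind w + i] (mod int m)"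
    proof -
      \<comment> \<open>The two congruences differ, up to sign, by the one that defines
        \<open>i\<close>.\<close>
      have "F1.ind u - (F2.ind w + i) =
          (F1.ind x - F2.ind y - i) - (F1.ind x - F1.ind u - (F2.ind y - F2.ind w))" by simp
      moreover have "int m dvd F1.ind x - F2.ind y - i" using i by (simp add: cong_iff_dvd_diff)
      ultimately show ?thesis 
        by (simp only: cong_iff_dvd_diff dvd_diff_right_iff)
    qed
    finally have 1: "same (x / u) (y / w) \<longleftrightarrow> [F1.ind u = F2.ind w + i] (mod int m)" .
    have 2: "same (x / u - x) (y / w - y) \<longleftrightarrow> same (u - 1) (w - 1)" if s: "same (x / u) (y / w)"
    proof -
      \<comment> \<open>Both coordinates pick up a factor -1, whose indices cancel by
        \<open>minus\<close>; the factors x / u and y / w cancel by \<open>s\<close>.\<close>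
      have "x / u - x = - (x / u * (u - 1))" "y / w - y = - (y / w * (w - 1))"
        using uw by (simp_all add: field_simps)
      then have "[F1.ind (x / u - x) = F1.ind (- 1) + F1.ind (x / u) + F1.ind (u - 1)] (mod int m)"
        and "[F2.ind (y / w - y) = F2.ind (- 1) + F2.ind (y / w) + F2.ind (w - 1)] (mod int m)"
        using F1.cong_ind_minus[of "x / u * (u - 1)"] F1.cong_ind_mult[of "x / u" "u - 1"]
          F2.cong_ind_minus[of "y / w * (w - 1)"] F2.cong_ind_mult[of "y / w" "w - 1"] uw xy
        by (auto simp: cong_def add.assoc mod_simps intro: mod_add_cong)
      then have "same (x / u - x) (y / w - y) \<longleftrightarrow>
          [F1.ind (- 1) + F1.ind (x / u) + F1.ind (u - 1) =
           F2.ind (- 1) + F2.ind (y / w) + F2.ind (w - 1)] (mod int m)"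
        by (simp add: same_def cong_def)
      also have "\<dots> \<longleftrightarrow> same (u - 1) (w - 1)"
        using cong_add_cancel_cong[OF cong_add[OF minus s[unfolded same_def]]] by (simp add: same_def)
      finally show ?thesis .
    qed
    show ?thesis using 1 2 by blast
  qed
  have "bij_betw (\<lambda>(u, w). (x / u, y / w)) ?P ?C" (is "bij_betw ?f _ _")
  proof (rule bij_betw_byWitness[where f' = ?f])
    show "\<forall>p\<in>?P. ?f (?f p) = p" "\<forall>p\<in>?C. ?f (?f p) = p" using xy by auto
    show "?f ` ?P \<subseteq> ?C" using xy iff by (auto simp: divide_eq_eq)
    show "?f ` ?C \<subseteq> ?P"
    proof
      fix p assume "p \<in> ?f ` ?C"
      then obtain z w where p: "p = (x / z, y / w)" and *: "(z, w) \<in> ?C" by auto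
      then show "p \<in> ?P" using iff[of "x / z" "y / w"] xy by auto
    qed
  qed
  then show ?thesis
    unfolding cyclotomic_sum_eq by (rule bij_betw_same_card[symmetric])
qed

text \<open>The two losses in \<open>common_decompose\<close> occur together, since negation
  preserves \<open>same\<close>; the remaining term is the cyclotomic sum.\<close>

lemma common_D:
  assumes "[F1.ind (- 1) = F2.ind (- 1)] (mod int m)"
    and "x \<noteq> 0" "y \<noteq> 0" "[F1.ind x - F2.ind y = i] (mod int m)"
  shows "common (x, y) = (if same x y then 2 * (n\<^sub>1 - 1) else 2 * n\<^sub>1) + \<X> m \<alpha>\<^sub>1 \<alpha>\<^sub>2 0 0 i"
  using common_decompose[of y x] card_shifted_pairs[OF assms] assms by (simp add: same_minus_iff)

section \<open>The graph\<close>

lemma Gamma_graph_eq: "Gamma_graph m \<alpha>\<^sub>1 \<alpha>\<^sub>2 = cayley_digraph conn"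
  by (simp add: Gamma_graph_def conn_def)

text \<open>The axis neighbours of an off-axis vertex (x, y) form a translate of the index class
  matching -y, which has \<open>n\<^sub>1\<close> elements.\<close>

lemma regular_clique_axis: "regular_clique (cayley_digraph conn) n\<^sub>1 (UNIV \<times> {0})"
proof -
  have "card {w \<in> UNIV \<times> {0}. w - (x, y) \<in> conn} = n\<^sub>1" if "y \<noteq> 0" for x y
  proof -
    have "{w \<in> UNIV \<times> {0}. w - (x, y) \<in> conn} = (\<lambda>z. (z + x, 0)) ` {z. z \<noteq> 0 \<and> same z (- y)}"
      (is "?L = ?R")
    proof
      show "?R \<subseteq> ?L" using that by (auto simp: conn_iff)
      show "?L \<subseteq> ?R"
      proof
        fix w assume w: "w \<in> ?L"
        then obtain z where z: "w = (z, 0)" by auto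
        with w that have "z - x \<in> {z. z \<noteq> 0 \<and> same z (- y)}" by (simp add: conn_iff)
        moreover have "w = (z - x + x, 0)" using z by simp
        ultimately show "w \<in> ?R" by blast
      qed
    qed
    then show ?thesis using card_same_left[of "- y"] by (simp add: card_image inj_on_def)
  qed
  moreover have "graph_clique (cayley_digraph conn) (UNIV \<times> {0})"
    by (auto simp: graph_clique_def conn_iff)
  ultimately show ?thesis using F1.n_pos by (auto simp: regular_clique_def)
qed

lemma not_complete_digraph: "\<not> complete_digraph k (with_proj (cayley_digraph conn))"
proof
  assume "complete_digraph k (with_proj (cayley_digraph conn))"
  then have "arcs_ends (with_proj (cayley_digraph conn)) = {(u, v). u \<noteq> v}"
    by (simp add: complete_digraph_def)
  then have "parcs (cayley_digraph conn) = {(u, v). u \<noteq> v}"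
    by (simp add: arcs_ends_def arc_to_ends_def)
  \<comment> \<open>No element of \<open>conn\<close> has first coordinate 0, so these two vertices
    are not adjacent.\<close>
  then have "((0, 0), (0, 1)) \<in> parcs (cayley_digraph conn)" by simp
  then show False by (simp add: conn_iff)
qed

text \<open>The degree is automatically constant and undirectedness is the condition on -1. Each of
  the two kinds of neighbour, on and off the axis, has a constant count, so \<open>l\<close> has to
  equal both.\<close>

lemma edge_regular_conn_iff:
  "edge_regular (cayley_digraph conn) v k l \<longleftrightarrow>
    [F1.ind (- 1) = F2.ind (- 1)] (mod int m) \<and>
    v = (1 + m * n\<^sub>1) * (1 + m * n\<^sub>2) \<and> k = m * n\<^sub>1 * (n\<^sub>2 + 1) \<and>
    l = m * n\<^sub>1 - 1 + (n\<^sub>1 - 1) * n\<^sub>2 \<and> l = 2 * (n\<^sub>1 - 1) + \<X> m \<alpha>\<^sub>1 \<alpha>\<^sub>2 0 0 0"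
proof (cases "[F1.ind (- 1) = F2.ind (- 1)] (mod int m)")
  case True
  have D: "common (x, y) = 2 * (n\<^sub>1 - 1) + \<X> m \<alpha>\<^sub>1 \<alpha>\<^sub>2 0 0 0" if "x \<noteq> 0" "y \<noteq> 0" "same x y" for x y
    using common_D[OF True that(1,2), of 0] that(3) by (simp add: same_def cong_diff_iff_cong_0)
  have "(\<forall>d\<in>conn. common d = l) \<longleftrightarrow>
      l = m * n\<^sub>1 - 1 + (n\<^sub>1 - 1) * n\<^sub>2 \<and> l = 2 * (n\<^sub>1 - 1) + \<X> m \<alpha>\<^sub>1 \<alpha>\<^sub>2 0 0 0" (is "?L \<longleftrightarrow> ?R")
  proof
    assume L: ?L
    \<comment> \<open>One neighbour of each kind suffices to read off both values.\<close>
    have "(1, 0) \<in> conn" "(1, 1) \<in> conn" "same 1 1" by (auto simp: conn_iff same_def)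
    with L show ?R using common_C1[of 1] D[of 1 1] by force
  next
    assume R: ?R
    have "common (x, y) = l" if "(x, y) \<in> conn" for x y
      using that common_C1[of x] D[of x y] R by (cases "y = 0") (simp_all add: conn_iff)
    then show ?L by auto
  qed
  then show ?thesis
    using True symmetric_connection_iff F1.card_field F2.card_field
    by (auto simp: edge_regular_cayley_iff card_conn common_def)
qed (simp add: edge_regular_cayley_iff symmetric_connection_iff)

lemma neumaier_graph_conn_iff:
  "neumaier_graph (cayley_digraph conn) \<longleftrightarrow> (\<exists>v k l. edge_regular (cayley_digraph conn) v k l)"
  using regular_clique_axis not_complete_digraph by (auto simp: neumaier_graph_def)

text \<open>Nonzero axis points lie in \<open>conn\<close>, so the second coordinate of
  \<open>d\<close> is nonzero. If the first is 0, the vertical count applies; otherwise the indices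
  differ modulo \<open>m\<close>, which is why the residue 0 does not occur.\<close>

lemma common_nonadjacent:
  assumes "[F1.ind (- 1) = F2.ind (- 1)] (mod int m)" "d \<noteq> 0" "d \<notin> conn"
  shows "common d \<in> {n\<^sub>1 * (n\<^sub>2 + 1)} \<union> (\<Union>i\<in>{1..m - 1}. {2 * n\<^sub>1 + \<X> m \<alpha>\<^sub>1 \<alpha>\<^sub>2 0 0 (int i)})"
proof -
  obtain x y where d: "d = (x, y)" by (cases d)
  have "y \<noteq> 0" using assms(2,3) by (auto simp: d conn_iff zero_prod_def)
  show ?thesis
  proof (cases "x = 0")
    case True
    then show ?thesis using common_vertical[OF \<open>y \<noteq> 0\<close>] by (simp add: d)
  next
    case False
    define i where "i = nat ((F1.ind x - F2.ind y) mod int m)"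
    have i: "int i = (F1.ind x - F2.ind y) mod int m" using F1.m_pos by (simp add: i_def)
    have ns: "\<not> same x y" using assms(3) False by (simp add: d conn_iff)
    then have "int i \<noteq> 0"
      unfolding i same_def by (metis cong_0_iff cong_diff_iff_cong_0 dvd_eq_mod_eq_0)
    moreover have "int i < int m" unfolding i using F1.m_pos by simp
    ultimately have "i \<in> {1..m - 1}" by auto
    moreover have "common d = 2 * n\<^sub>1 + \<X> m \<alpha>\<^sub>1 \<alpha>\<^sub>2 0 0 (int i)"
      using common_D[OF assms(1) False \<open>y \<noteq> 0\<close>, of "int i"] ns by (simp add: d i cong_def)
    ultimately show ?thesis by blast
  qed
qed

end

theorem theorem3p9:
  fixes m n\<^sub>1 n\<^sub>2 q\<^sub>1 q\<^sub>2 :: nat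
    and \<alpha>\<^sub>1 :: "'a::finite_field" and \<alpha>\<^sub>2 :: "'b::finite_field"
  assumes "m \<ge> 2" and "n\<^sub>1 \<ge> 1" and "n\<^sub>2 \<ge> 1"
    and "q\<^sub>1 = 1 + m * n\<^sub>1" and "q\<^sub>2 = 1 + m * n\<^sub>2"
    and "primepow q\<^sub>1" and "primepow q\<^sub>2"
    and "CARD('a) = q\<^sub>1" and "CARD('b) = q\<^sub>2"
    and "primitive_element \<alpha>\<^sub>1" and "primitive_element \<alpha>\<^sub>2"
  shows "(neumaier_graph (Gamma_graph m \<alpha>\<^sub>1 \<alpha>\<^sub>2) \<longleftrightarrow>
            [q\<^sub>1 * n\<^sub>1 = q\<^sub>2 * n\<^sub>2] (mod 2) \<and>
            int (\<X> m \<alpha>\<^sub>1 \<alpha>\<^sub>2 0 0 0) = int q\<^sub>1 + int n\<^sub>1 * int n\<^sub>2 - 2 * int n\<^sub>1 - int n\<^sub>2) \<and>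
         (neumaier_graph (Gamma_graph m \<alpha>\<^sub>1 \<alpha>\<^sub>2) \<longrightarrow>
            neumaier_parameters (Gamma_graph m \<alpha>\<^sub>1 \<alpha>\<^sub>2)
              (q\<^sub>1 * q\<^sub>2) ((q\<^sub>1 - 1) * (n\<^sub>2 + 1)) (q\<^sub>1 - 2 + (n\<^sub>1 - 1) * n\<^sub>2) n\<^sub>1 q\<^sub>1 \<and>
            (\<forall>u \<in> pverts (Gamma_graph m \<alpha>\<^sub>1 \<alpha>\<^sub>2). \<forall>w \<in> pverts (Gamma_graph m \<alpha>\<^sub>1 \<alpha>\<^sub>2).
               u \<noteq> w \<and> (u, w) \<notin> parcs (Gamma_graph m \<alpha>\<^sub>1 \<alpha>\<^sub>2) \<longrightarrow>
               card (common_neighbours (Gamma_graph m \<alpha>\<^sub>1 \<alpha>\<^sub>2) u w)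
                 \<in> {n\<^sub>1 * (n\<^sub>2 + 1)} \<union> (\<Union>i\<in>{1..m - 1}. {2 * n\<^sub>1 + \<X> m \<alpha>\<^sub>1 \<alpha>\<^sub>2 0 0 (int i)})))"
proof -
  interpret cyclotomic_pair m n\<^sub>1 n\<^sub>2 \<alpha>\<^sub>1 \<alpha>\<^sub>2
    using assms(1-5,8-11) by unfold_locales simp_all
  let ?G = "cayley_digraph conn" and ?l = "m * n\<^sub>1 - 1 + (n\<^sub>1 - 1) * n\<^sub>2"
  let ?minus = "[F1.ind (- 1) = F2.ind (- 1)] (mod int m)"
  \<comment> \<open>Positivity of \<open>m * n\<^sub>1\<close> and \<open>n\<^sub>1\<close> rules
    out truncation, so equality of the two counts can be rearranged over the integers into the
    stated equation.\<close>
  have "int (m * n\<^sub>1 - 1) = int q\<^sub>1 - 2" "int (n\<^sub>1 - 1) = int n\<^sub>1 - 1"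
    using assms(1,2,4) by (simp_all del: of_nat_mult)
  then have "int ?l = int q\<^sub>1 - 2 + int n\<^sub>1 * int n\<^sub>2 - int n\<^sub>2"
    and "int (2 * (n\<^sub>1 - 1) + \<X> m \<alpha>\<^sub>1 \<alpha>\<^sub>2 0 0 0) = 2 * int n\<^sub>1 - 2 + int (\<X> m \<alpha>\<^sub>1 \<alpha>\<^sub>2 0 0 0)"
    by (simp_all only: of_nat_add of_nat_mult of_nat_numeral left_diff_distrib right_diff_distrib)
  then have lambda: "?l = 2 * (n\<^sub>1 - 1) + \<X> m \<alpha>\<^sub>1 \<alpha>\<^sub>2 0 0 0 \<longleftrightarrow>
      int (\<X> m \<alpha>\<^sub>1 \<alpha>\<^sub>2 0 0 0) = int q\<^sub>1 + int n\<^sub>1 * int n\<^sub>2 - 2 * int n\<^sub>1 - int n\<^sub>2"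
    by linarith
  have iff: "neumaier_graph ?G \<longleftrightarrow> ?minus \<and> ?l = 2 * (n\<^sub>1 - 1) + \<X> m \<alpha>\<^sub>1 \<alpha>\<^sub>2 0 0 0"
    unfolding neumaier_graph_conn_iff edge_regular_conn_iff by blast
  have "neumaier_parameters ?G (q\<^sub>1 * q\<^sub>2) ((q\<^sub>1 - 1) * (n\<^sub>2 + 1)) (q\<^sub>1 - 2 + (n\<^sub>1 - 1) * n\<^sub>2) n\<^sub>1 q\<^sub>1"
    if "neumaier_graph ?G"
  proof -
    have "edge_regular ?G (q\<^sub>1 * q\<^sub>2) ((q\<^sub>1 - 1) * (n\<^sub>2 + 1)) (q\<^sub>1 - 2 + (n\<^sub>1 - 1) * n\<^sub>2)"
      using that unfolding iff edge_regular_conn_iff assms(4,5) by auto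
    moreover have "card (UNIV \<times> {0} :: ('a \<times> 'b) set) = q\<^sub>1"
      using assms(8) by (simp add: card_cartesian_product)
    ultimately show ?thesis
      using that regular_clique_axis unfolding neumaier_parameters_def by blast
  qed
  moreover have "card (common_neighbours ?G u w) \<in>
      {n\<^sub>1 * (n\<^sub>2 + 1)} \<union> (\<Union>i\<in>{1..m - 1}. {2 * n\<^sub>1 + \<X> m \<alpha>\<^sub>1 \<alpha>\<^sub>2 0 0 (int i)})"
    if "neumaier_graph ?G" "u \<noteq> w" "(u, w) \<notin> parcs ?G" for u w
    using common_nonadjacent[of "w - u"] that
    unfolding iff card_common_neighbours_cayley common_def by simp
  moreover have "neumaier_graph ?G \<longleftrightarrow> [q\<^sub>1 * n\<^sub>1 = q\<^sub>2 * n\<^sub>2] (mod 2) \<and>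
      int (\<X> m \<alpha>\<^sub>1 \<alpha>\<^sub>2 0 0 0) = int q\<^sub>1 + int n\<^sub>1 * int n\<^sub>2 - 2 * int n\<^sub>1 - int n\<^sub>2"
    unfolding iff lambda ind_minus_one_cong_iff_parity assms(4,5) ..
  ultimately show ?thesis unfolding Gamma_graph_eq by blast
qed

end
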